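(* Let $(W,S,* )$ be a twisted Coxeter system with $W$ finite, and let $w_0$ be the longest element of $W$. Let $x,y \in \mathcal{I}_*$ with $x \leq_{T,*} y$. If either $\ell(x) = \hat\ell_*(x)$ or $\ell(w_0)-\ell(y) = \hat\ell_*(w_0)-\hat\ell_*(y)$, then $\mathcal{A}_*(x,y) = \mathcal{A}'_*(x,y)$.
   Context: A twisted Coxeter system $(W,S,* )$ is a Coxeter system $(W,S)$ with length function $\ell$ together with an automorphism $*$ of $W$ (written $w\mapsto w^*$) satisfying $S^*=S$ and $(w^* )^*=w$. Let $\mathcal{I}_*=\{w\in W: w^{-1}=w^*\}$. The Demazure product $\circ$ is the unique associative operation on $W$ with $s\circ w = sw$ if $\ell(sw)>\ell(w)$ and $s\circ w=w$ otherwise, and $w\circ s=ws$ if $\ell(ws)>\ell(w)$ and $w\circ s = w$ otherwise, for $s\in S$, $w\in W$. For $x,w\in W$ put $x\ltimes_* w = (w^* )^{-1}\circ x\circ w$. For $x,y\in\mathcal{I}_*$, $\mathcal{B}_*(x,y)=\{w\in W: x\ltimes_* w = y\}$ and $\mathcal{A}_*(x,y)$ is the set of minimal-length elements of $\mathcal{B}_*(x,y)$. For $x\in\mathcal{I}_*$, $\hat\ell_*(x)$ is the minimum of $\ell(w)$ over $w\in W$ with $1\ltimes_* w = x$. For $x\in\mathcal{I}_*$ and $s\in S$ let $x\rtimes_* s = s^*xs$ if $s^*x\ne xs$ and $x\rtimes_* s = xs$ if $s^*x=xs$. The order $\leq_{T,*}$ on $\mathcal{I}_*$ is the reflexive transitive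 closure of the relation $w <_{T,*} w\rtimes_* s$ for $w\in\mathcal{I}_*$, $s\in S$ with $\hat\ell_*(w)<\hat\ell_*(w\rtimes_* s)$. Let $\leq$ be the Bruhat order on $W$. $\mathcal{A}'_*(x,y)$ denotes the set of minimal-length elements of $\mathcal{B}'_*(x,y)=\{w\in W: w^*y\leq xw\}$. *)

theory Defs
  imports "HOL-Algebra.Generated_Groups" "HOL-Library.Extended_Nat"
begin

definition word_prod :: "('a, 'b) monoid_scheme \<Rightarrow> 'a list \<Rightarrow> 'a" where
  "word_prod W u = foldr (\<lambda>s w. s \<otimes>\<^bsub>W\<^esub> w) u \<one>\<^bsub>W\<^esub>"

definition coxeter_matrix :: "'a set \<Rightarrow> ('a \<Rightarrow> 'a \<Rightarrow> enat) \<Rightarrow> bool" where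
  "coxeter_matrix S m \<longleftrightarrow>
     (\<forall>s\<in>S. m s s = 1) \<and>
     (\<forall>s\<in>S. \<forall>t\<in>S. m s t = m t s) \<and>
     (\<forall>s\<in>S. \<forall>t\<in>S. s \<noteq> t \<longrightarrow> 2 \<le> m s t)"

text \<open>
  The congruence on words in \<open>S\<close> generated by the relations \<open>(st)^(m s t) = 1\<close> (no relation if
  \<open>m s t = \<infinity>\<close>). As \<open>m s s = 1\<close>, every letter is its own inverse, so words without
  formal inverses suffice to describe the group with this presentation.
\<close>

inductive coxeter_cong :: "'a set \<Rightarrow> ('a \<Rightarrow> 'a \<Rightarrow> enat) \<Rightarrow> 'a list \<Rightarrow> 'a list \<Rightarrow> bool"
  for S m where
  rel: "\<lbrakk>s \<in> S; t \<in> S; m s t = enat k\<rbrakk>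
          \<Longrightarrow> coxeter_cong S m (u @ concat (replicate k [s, t]) @ v) (u @ v)"
| refl: "coxeter_cong S m u u"
| sym: "coxeter_cong S m u v \<Longrightarrow> coxeter_cong S m v u"
| trans: "\<lbrakk>coxeter_cong S m u v; coxeter_cong S m v w\<rbrakk> \<Longrightarrow> coxeter_cong S m u w"

locale coxeter_system = group W
  for W :: "('a, 'b) monoid_scheme" (structure) +
  fixes S :: "'a set"
  assumes S_subset: "S \<subseteq> carrier W"
    and S_generates: "generate W S = carrier W"
    and presentation: "\<exists>m. coxeter_matrix S m \<and>
          (\<forall>u \<in> lists S. \<forall>v \<in> lists S. word_prod W u = word_prod W v \<longleftrightarrow> coxeter_cong S m u v)"

locale twisted_coxeter_system = coxeter_system W S
  for W :: "('a, 'b) monoid_scheme" (structure) and S :: "'a set" +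
  fixes star :: "'a \<Rightarrow> 'a"
  assumes star_automorphism: "star \<in> iso W W"
    and star_S: "star ` S = S"
    and star_star: "w \<in> carrier W \<Longrightarrow> star (star w) = w"

definition cox_length :: "('a, 'b) monoid_scheme \<Rightarrow> 'a set \<Rightarrow> 'a \<Rightarrow> nat" where
  "cox_length W S w = (LEAST n. \<exists>u \<in> lists S. length u = n \<and> word_prod W u = w)"

definition is_longest :: "('a, 'b) monoid_scheme \<Rightarrow> 'a set \<Rightarrow> 'a \<Rightarrow> bool" where
  "is_longest W S w\<^sub>0 \<longleftrightarrow>
     w\<^sub>0 \<in> carrier W \<and> (\<forall>w \<in> carrier W. cox_length W S w \<le> cox_length W S w\<^sub>0)"

definition min_length_elements :: "('a, 'b) monoid_scheme \<Rightarrow> 'a set \<Rightarrow> 'a set \<Rightarrow> 'a set" where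
  "min_length_elements W S X = {w \<in> X. \<forall>v \<in> X. cox_length W S w \<le> cox_length W S v}"

definition reflections :: "('a, 'b) monoid_scheme \<Rightarrow> 'a set \<Rightarrow> 'a set" where
  "reflections W S = {w \<otimes>\<^bsub>W\<^esub> s \<otimes>\<^bsub>W\<^esub> inv\<^bsub>W\<^esub> w | w s. w \<in> carrier W \<and> s \<in> S}"

definition bruhat_le :: "('a, 'b) monoid_scheme \<Rightarrow> 'a set \<Rightarrow> 'a \<Rightarrow> 'a \<Rightarrow> bool" where
  "bruhat_le W S = (\<lambda>u v. u \<in> carrier W \<and> v \<in> carrier W \<and>
     (u, v) \<in> {(w, w \<otimes>\<^bsub>W\<^esub> t) | w t. w \<in> carrier W \<and> t \<in> reflections W S \<and>
                  cox_length W S w < cox_length W S (w \<otimes>\<^bsub>W\<^esub> t)}\<^sup>*)"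

text \<open>
  The unit condition is needed for uniqueness: the other conditions determine the product on all
  pairs but \<open>(\<one>, \<one>)\<close>, and if \<open>S = {s}\<close> they also hold for the constant operation with value \<open>s\<close>.
  The last condition fixes the values outside the carrier.
\<close>

definition is_demazure_product ::
    "('a, 'b) monoid_scheme \<Rightarrow> 'a set \<Rightarrow> ('a \<Rightarrow> 'a \<Rightarrow> 'a) \<Rightarrow> bool" where
  "is_demazure_product W S d \<longleftrightarrow>
     (\<forall>x \<in> carrier W. \<forall>y \<in> carrier W. d x y \<in> carrier W) \<and>
     (\<forall>x \<in> carrier W. \<forall>y \<in> carrier W. \<forall>z \<in> carrier W. d (d x y) z = d x (d y z)) \<and>
     (\<forall>w \<in> carrier W. d \<one>\<^bsub>W\<^esub> w = w \<and> d w \<one>\<^bsub>W\<^esub> = w) \<and>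
     (\<forall>s \<in> S. \<forall>w \<in> carrier W.
        d s w = (if cox_length W S (s \<otimes>\<^bsub>W\<^esub> w) > cox_length W S w then s \<otimes>\<^bsub>W\<^esub> w else w)) \<and>
     (\<forall>s \<in> S. \<forall>w \<in> carrier W.
        d w s = (if cox_length W S (w \<otimes>\<^bsub>W\<^esub> s) > cox_length W S w then w \<otimes>\<^bsub>W\<^esub> s else w)) \<and>
     (\<forall>x y. x \<notin> carrier W \<or> y \<notin> carrier W \<longrightarrow> d x y = undefined)"

definition demazure :: "('a, 'b) monoid_scheme \<Rightarrow> 'a set \<Rightarrow> 'a \<Rightarrow> 'a \<Rightarrow> 'a" where
  "demazure W S = (THE d. is_demazure_product W S d)"

definition twisted_involutions :: "('a, 'b) monoid_scheme \<Rightarrow> ('a \<Rightarrow> 'a) \<Rightarrow> 'a set" where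
  "twisted_involutions W star = {w \<in> carrier W. inv\<^bsub>W\<^esub> w = star w}"

definition twisted_dem_conj ::
    "('a, 'b) monoid_scheme \<Rightarrow> 'a set \<Rightarrow> ('a \<Rightarrow> 'a) \<Rightarrow> 'a \<Rightarrow> 'a \<Rightarrow> 'a" where
  "twisted_dem_conj W S star x w = demazure W S (demazure W S (inv\<^bsub>W\<^esub> (star w)) x) w"

definition hecke_set ::
    "('a, 'b) monoid_scheme \<Rightarrow> 'a set \<Rightarrow> ('a \<Rightarrow> 'a) \<Rightarrow> 'a \<Rightarrow> 'a \<Rightarrow> 'a set" where
  "hecke_set W S star x y = {w \<in> carrier W. twisted_dem_conj W S star x w = y}"

definition atoms ::
    "('a, 'b) monoid_scheme \<Rightarrow> 'a set \<Rightarrow> ('a \<Rightarrow> 'a) \<Rightarrow> 'a \<Rightarrow> 'a \<Rightarrow> 'a set" where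
  "atoms W S star x y = min_length_elements W S (hecke_set W S star x y)"

definition inv_length :: "('a, 'b) monoid_scheme \<Rightarrow> 'a set \<Rightarrow> ('a \<Rightarrow> 'a) \<Rightarrow> 'a \<Rightarrow> nat" where
  "inv_length W S star x =
     (LEAST n. \<exists>w \<in> carrier W. cox_length W S w = n \<and> twisted_dem_conj W S star \<one>\<^bsub>W\<^esub> w = x)"

definition twisted_conj :: "('a, 'b) monoid_scheme \<Rightarrow> ('a \<Rightarrow> 'a) \<Rightarrow> 'a \<Rightarrow> 'a \<Rightarrow> 'a" where
  "twisted_conj W star x s =
     (if star s \<otimes>\<^bsub>W\<^esub> x \<noteq> x \<otimes>\<^bsub>W\<^esub> s then star s \<otimes>\<^bsub>W\<^esub> x \<otimes>\<^bsub>W\<^esub> s else x \<otimes>\<^bsub>W\<^esub> s)"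

definition twisted_weak_le ::
    "('a, 'b) monoid_scheme \<Rightarrow> 'a set \<Rightarrow> ('a \<Rightarrow> 'a) \<Rightarrow> 'a \<Rightarrow> 'a \<Rightarrow> bool" where
  "twisted_weak_le W S star = (\<lambda>x y.
     x \<in> twisted_involutions W star \<and> y \<in> twisted_involutions W star \<and>
     (x, y) \<in> {(w, twisted_conj W star w s) | w s. w \<in> twisted_involutions W star \<and> s \<in> S \<and>
                  inv_length W S star w < inv_length W S star (twisted_conj W star w s)}\<^sup>*)"

definition hecke_set' ::
    "('a, 'b) monoid_scheme \<Rightarrow> 'a set \<Rightarrow> ('a \<Rightarrow> 'a) \<Rightarrow> 'a \<Rightarrow> 'a \<Rightarrow> 'a set" where
  "hecke_set' W S star x y =
     {w \<in> carrier W. bruhat_le W S (star w \<otimes>\<^bsub>W\<^esub> y) (x \<otimes>\<^bsub>W\<^esub> w)}"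

definition atoms' ::
    "('a, 'b) monoid_scheme \<Rightarrow> 'a set \<Rightarrow> ('a \<Rightarrow> 'a) \<Rightarrow> 'a \<Rightarrow> 'a \<Rightarrow> 'a set" where
  "atoms' W S star x y = min_length_elements W S (hecke_set' W S star x y)"

end

theory Submission
  imports Defs
begin

text \<open>
  If \<open>w\<^sup>* y \<le> x w\<close> in the Bruhat order, then multiplying from the left by \<open>(w\<^sup>*)\<^sup>-\<^sup>1\<close> with the
  Demazure product gives \<open>y \<le> x \<ltimes> w\<close>. On twisted involutions the involution length is strictly
  monotone for the Bruhat order, by induction using the lifting property, so the length of \<open>w\<close> is
  at least the difference of the involution lengths of \<open>y\<close> and \<open>x\<close>, with equality only if
  \<open>x \<ltimes> w = y\<close>. Since \<open>x \<le> y\<close> in the twisted weak order, this bound is attained in the set of all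
  \<open>w\<close> with \<open>x \<ltimes> w = y\<close>. Its elements attaining it satisfy \<open>x \<circ> w = x w\<close>, and
  \<open>a\<^sup>-\<^sup>1 (a \<circ> b) \<le> b\<close> for \<open>a = (w\<^sup>*)\<^sup>-\<^sup>1\<close> and \<open>b = x w\<close> then gives \<open>w\<^sup>* y \<le> x w\<close>.
\<close>

section \<open>Words in the generators and the parity of their reflections\<close>

context coxeter_system
begin

abbreviation len :: "'a \<Rightarrow> nat" where "len \<equiv> cox_length W S"
abbreviation wprod :: "'a list \<Rightarrow> 'a" where "wprod \<equiv> word_prod W"
abbreviation refls :: "'a set" where "refls \<equiv> reflections W S"

declare in_listsD [rule del] in_listsI [rule del] Cons_in_lists_iff [simp]

lemma rev_in_lists [simp]: "rev u \<in> lists A \<longleftrightarrow> u \<in> lists A"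
  by (simp add: in_lists_conv_set)

lemma S_closed [simp]: "s \<in> S \<Longrightarrow> s \<in> carrier W"
  using S_subset by auto

lemma wprod_Nil [simp]: "wprod [] = \<one>"
  and wprod_Cons [simp]: "wprod (s # u) = s \<otimes> wprod u"
  by (simp_all add: word_prod_def)

lemma wprod_closed [simp]: "u \<in> lists S \<Longrightarrow> wprod u \<in> carrier W"
  by (induction u) auto

lemma wprod_append [simp]:
  "\<lbrakk>u \<in> lists S; v \<in> lists S\<rbrakk> \<Longrightarrow> wprod (u @ v) = wprod u \<otimes> wprod v"
  by (induction u) (auto simp: m_assoc)

lemma S_square [simp]: assumes "s \<in> S" shows "s \<otimes> s = \<one>"
proof -
  obtain m where m: "coxeter_matrix S m"
    "\<forall>u \<in> lists S. \<forall>v \<in> lists S. wprod u = wprod v \<longleftrightarrow> coxeter_cong S m u v"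
    using presentation by blast
  have "m s s = enat 1"
    using m(1) assms by (simp add: coxeter_matrix_def one_enat_def)
  from coxeter_cong.rel[of s S s m 1 "[]" "[]", OF assms assms this]
  have "coxeter_cong S m [s, s] []" by simp
  then have "wprod [s, s] = wprod []"
    using m(2) assms by (metis Cons_in_lists_iff lists.Nil)
  then show ?thesis using assms by simp
qed

lemma S_cancel [simp]:
  "\<lbrakk>s \<in> S; w \<in> carrier W\<rbrakk> \<Longrightarrow> s \<otimes> (s \<otimes> w) = w"
  "\<lbrakk>s \<in> S; w \<in> carrier W\<rbrakk> \<Longrightarrow> w \<otimes> s \<otimes> s = w"
proof -
  show "s \<otimes> (s \<otimes> w) = w" if "s \<in> S" "w \<in> carrier W"
    using that by (simp flip: m_assoc)
  show "w \<otimes> s \<otimes> s = w" if "s \<in> S" "w \<in> carrier W"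
    using that by (simp add: m_assoc)
qed

lemma S_inv [simp]: "s \<in> S \<Longrightarrow> inv s = s"
  by (simp add: inv_equality)

lemma wprod_rev: "u \<in> lists S \<Longrightarrow> wprod (rev u) = inv (wprod u)"
  by (induction u) (auto simp: inv_mult_group)

lemma ex_word: "w \<in> carrier W \<Longrightarrow> \<exists>u \<in> lists S. wprod u = w"
proof -
  assume "w \<in> carrier W"
  then have "w \<in> generate W S" using S_generates by simp
  then show ?thesis
  proof (induction rule: generate.induct)
    case one
    show ?case by (intro bexI[of _ "[]"]) auto
  next
    case (incl h)
    then show ?case by (intro bexI[of _ "[h]"]) auto
  next
    case (inv h)
    then show ?case by (intro bexI[of _ "[h]"]) auto
  next
    case (eng h1 h2)
    then obtain u v where "u \<in> lists S" "v \<in> lists S" "wprod u = h1" "wprod v = h2" by blast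
    then show ?case by (intro bexI[of _ "u @ v"]) auto
  qed
qed

text \<open>
  The number of occurrences of \<open>t\<close> among the reflections \<open>s\<^sub>1 \<dots> s\<^sub>i \<dots> s\<^sub>1\<close> of a word
  \<open>s\<^sub>1 \<dots> s\<^sub>k\<close>. Its parity depends only on the product of the word.
\<close>
primrec refl_count :: "'a list \<Rightarrow> 'a \<Rightarrow> nat" where
  "refl_count [] t = 0"
| "refl_count (s # u) t = of_bool (t = s) + refl_count u (s \<otimes> t \<otimes> s)"

text \<open>Each letter read conjugates the sought reflection, so the letters of \<open>v\<close>
  see \<open>t\<close> conjugated by the whole product of \<open>u\<close>.\<close>

lemma refl_count_append:
  "\<lbrakk>u \<in> lists S; t \<in> carrier W\<rbrakk> \<Longrightarrow>
     refl_count (u @ v) t = refl_count u t + refl_count v (inv (wprod u) \<otimes> t \<otimes> wprod u)"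
  by (induction u arbitrary: t) (auto simp: inv_mult_group m_assoc)

text \<open>The reflections of the alternating word are \<open>s\<close>, \<open>sts\<close>,
  \<open>ststs\<close> and so on, and the one at position \<open>i\<close>, counted from 0, is
  \<open>(st)^i s\<close>.\<close>

lemma refl_count_alternating:
  assumes "s \<in> S" "t \<in> S" "r \<in> carrier W"
  shows "refl_count (concat (replicate k [s, t])) r
           = (\<Sum>i<2*k. of_bool (r = (s \<otimes> t) [^] i \<otimes> s))"
  using assms(3)
proof (induction k arbitrary: r)
  case 0
  show ?case by simp
next
  case (Suc k)
  let ?p = "s \<otimes> t"
  have p: "?p \<in> carrier W" using assms by simp
  \<comment> \<open>Reading the first two letters replaces \<open>r\<close> by
    \<open>t s r s t\<close>, which amounts to a shift of the exponent by two.\<close>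
  have "t \<otimes> (s \<otimes> r \<otimes> s) \<otimes> t = ?p [^] i \<otimes> s \<longleftrightarrow> r = ?p [^] Suc (Suc i) \<otimes> s" for i :: nat
  proof -
    have "?p \<otimes> (?p [^] i \<otimes> s) \<otimes> (t \<otimes> s) = ?p \<otimes> ?p [^] i \<otimes> ?p \<otimes> s"
      using assms p by (simp add: m_assoc)
    also have "\<dots> = ?p [^] Suc (Suc i) \<otimes> s"
      using nat_pow_Suc2[OF p, of i] p by simp
    finally have 1: "?p \<otimes> (?p [^] i \<otimes> s) \<otimes> (t \<otimes> s) = ?p [^] Suc (Suc i) \<otimes> s" .
    have 2: "?p \<otimes> (t \<otimes> (s \<otimes> r \<otimes> s) \<otimes> t) \<otimes> (t \<otimes> s) = r"
      using assms Suc.prems by (simp add: m_assoc)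
    have 3: "t \<otimes> (s \<otimes> (?p \<otimes> (?p [^] i \<otimes> s) \<otimes> (t \<otimes> s)) \<otimes> s) \<otimes> t = ?p [^] i \<otimes> s"
      using assms p by (simp add: m_assoc)
    show ?thesis using 1 2 3 by metis
  qed
  moreover have "s \<otimes> r \<otimes> s = t \<longleftrightarrow> r = ?p [^] Suc 0 \<otimes> s"
  proof -
    have 1: "s \<otimes> (s \<otimes> r \<otimes> s) \<otimes> s = r"
      using assms Suc.prems by (simp add: m_assoc)
    have 2: "s \<otimes> (s \<otimes> t \<otimes> s) \<otimes> s = t"
      using assms by (simp add: m_assoc)
    show ?thesis using 1 2 p by auto
  qed
  moreover have "t \<otimes> (s \<otimes> r \<otimes> s) \<otimes> t \<in> carrier W" using assms Suc.prems by simp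
  ultimately have "refl_count (concat (replicate (Suc k) [s, t])) r
      = of_bool (r = ?p [^] (0::nat) \<otimes> s) + (of_bool (r = ?p [^] Suc 0 \<otimes> s)
        + (\<Sum>i<2*k. of_bool (r = ?p [^] Suc (Suc i) \<otimes> s)))"
    using Suc.IH[of "t \<otimes> (s \<otimes> r \<otimes> s) \<otimes> t"] assms by simp
  also have "\<dots> = (\<Sum>i<2 * Suc k. of_bool (r = ?p [^] i \<otimes> s))"
    by (simp only: mult_Suc_right add_2_eq_Suc sum.lessThan_Suc_shift)
  finally show ?case .
qed

text \<open>If \<open>(st)^k\<close> is the unit, the \<open>2k\<close> reflections
  \<open>(st)^i s\<close> repeat with period \<open>k\<close>, so the second half doubles the count
  of the first.\<close>

lemma refl_count_relator:
  assumes "s \<in> S" "t \<in> S" "r \<in> carrier W" "(s \<otimes> t) [^] k = \<one>"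
  shows "even (refl_count (concat (replicate k [s, t])) r)"
proof -
  let ?f = "\<lambda>i. of_bool (r = (s \<otimes> t) [^] i \<otimes> s) :: nat"
  have per: "?f (i + k) = ?f i" for i :: nat
    using assms by (simp add: nat_pow_mult[symmetric])
  have "(\<Sum>i<2*k. ?f i) = (\<Sum>i<k. ?f i) + (\<Sum>i<k. ?f (i + k))"
    using sum.atLeastLessThan_concat[of 0 k "k+k" ?f] sum.shift_bounds_nat_ivl[of ?f 0 k k]
    by (simp add: mult_2 atLeast0LessThan)
  also have "\<dots> = 2 * (\<Sum>i<k. ?f i)"
    using per by simp
  finally show ?thesis
    using refl_count_alternating[OF assms(1-3), of k] by simp
qed

lemma wprod_concat_replicate:
  assumes "s \<in> S" "t \<in> S"
  shows "wprod (concat (replicate k [s, t])) = (s \<otimes> t) [^] k"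
proof (induction k)
  case (Suc k)
  then show ?case
    using assms nat_pow_Suc2[of "s \<otimes> t" k] by (simp add: m_assoc)
qed simp

lemma lists_concat_replicate:
  "\<lbrakk>s \<in> S; t \<in> S\<rbrakk> \<Longrightarrow> concat (replicate k [s, t]) \<in> lists S"
  by (induction k) auto

text \<open>Both parities survive each defining relation: a relator has even length and even counts,
  and as its product is the unit, the letters after it see the same conjugate of \<open>t\<close> as
  without it.\<close>

lemma word_parity:
  assumes "u \<in> lists S" "v \<in> lists S" "wprod u = wprod v"
  shows "even (length u) = even (length v)"
    and "t \<in> carrier W \<Longrightarrow> even (refl_count u t) = even (refl_count v t)"
proof -
  obtain m where m: "coxeter_matrix S m"
    "\<forall>u \<in> lists S. \<forall>v \<in> lists S. wprod u = wprod v \<longleftrightarrow> coxeter_cong S m u v"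
    using presentation by blast
  \<comment> \<open>\<open>coxeter_cong\<close> does not confine its words to
    \<open>lists S\<close>. The equivalence of membership is therefore part of the induction, so
    that the middle word of \<open>trans\<close> is known to be a word in \<open>S\<close>.\<close>
  have *: "(u \<in> lists S \<longleftrightarrow> v \<in> lists S) \<and> (u \<in> lists S \<longrightarrow>
     even (length u) = even (length v) \<and>
     (\<forall>t \<in> carrier W. even (refl_count u t) = even (refl_count v t)))"
    if "coxeter_cong S m u v" for u v
    using that
  proof (induction rule: coxeter_cong.induct)
    case (rel s t k u v)
    let ?c = "concat (replicate k [s, t])"
    have c: "?c \<in> lists S" using rel by (intro lists_concat_replicate)
    have "coxeter_cong S m ([] @ ?c @ []) ([] @ [])"
      using rel by (intro coxeter_cong.rel)
    then have "wprod ?c = wprod []" using m(2) c by (metis append_Nil append_Nil2 lists.Nil)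
    then have c1: "(s \<otimes> t) [^] k = \<one>" using wprod_concat_replicate[of s t k] rel by simp
    have "even (length ?c)" by (induction k) auto
    moreover have "even (refl_count (u @ ?c @ v) r) = even (refl_count (u @ v) r)"
      if "u \<in> lists S" "v \<in> lists S" "r \<in> carrier W" for r
      using that c c1 rel wprod_concat_replicate[of s t k]
      by (simp add: refl_count_append refl_count_relator)
    ultimately show ?case using c by auto
  qed auto
  have "coxeter_cong S m u v" using m(2) assms by blast
  from *[OF this] assms
  show "even (length u) = even (length v)"
    and "t \<in> carrier W \<Longrightarrow> even (refl_count u t) = even (refl_count v t)"
    by auto
qed

subsection \<open>Length and strong exchange\<close>

lemma len_wprod_le: "u \<in> lists S \<Longrightarrow> len (wprod u) \<le> length u"
  unfolding cox_length_def by (rule Least_le) auto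

lemma reduced_word:
  assumes "w \<in> carrier W"
  obtains u where "u \<in> lists S" "length u = len w" "wprod u = w"
proof -
  have "\<exists>n. \<exists>u \<in> lists S. length u = n \<and> wprod u = w"
    using ex_word[OF assms] by auto
  from LeastI_ex[OF this] show ?thesis
    using that unfolding cox_length_def by auto
qed

lemma len_one [simp]: "len \<one> = 0"
  using len_wprod_le[of "[]"] by simp

lemma len_eq_0: "w \<in> carrier W \<Longrightarrow> len w = 0 \<Longrightarrow> w = \<one>"
  by (metis reduced_word length_0_conv wprod_Nil)

lemma len_inv [simp]: "w \<in> carrier W \<Longrightarrow> len (inv w) = len w"
proof -
  have le: "len (inv w) \<le> len w" if w: "w \<in> carrier W" for w
  proof -
    obtain u where u: "u \<in> lists S" "length u = len w" "wprod u = w"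
      using reduced_word[OF w] .
    then have "rev u \<in> lists S" by simp
    from len_wprod_le[OF this] show ?thesis using u by (simp add: wprod_rev)
  qed
  assume "w \<in> carrier W"
  with le[of w] le[of "inv w"] show ?thesis by simp
qed

lemma len_mult_S_le:
  assumes "w \<in> carrier W" "s \<in> S"
  shows "len (w \<otimes> s) \<le> Suc (len w)"
proof -
  obtain u where u: "u \<in> lists S" "length u = len w" "wprod u = w"
    using reduced_word[OF assms(1)] .
  with len_wprod_le[of "u @ [s]"] assms show ?thesis by simp
qed

text \<open>One letter changes the length by at most one, and the parity of the length excludes
  equality.\<close>

lemma len_mult_S:
  assumes "w \<in> carrier W" "s \<in> S"
  shows "len (w \<otimes> s) = Suc (len w) \<or> len w = Suc (len (w \<otimes> s))"
proof -
  obtain u where u: "u \<in> lists S" "length u = len w" "wprod u = w"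
    using reduced_word[OF assms(1)] .
  obtain v where v: "v \<in> lists S" "length v = len (w \<otimes> s)" "wprod v = w \<otimes> s"
    using reduced_word[of "w \<otimes> s"] assms by auto
  have "even (length (u @ [s])) = even (length v)"
    using u v assms by (intro word_parity) auto
  then have "len (w \<otimes> s) \<noteq> len w" using u v by auto
  moreover have "len (w \<otimes> s) \<le> Suc (len w)" using len_mult_S_le assms .
  moreover have "len w \<le> Suc (len (w \<otimes> s))"
    using len_mult_S_le[of "w \<otimes> s" s] assms by simp
  ultimately show ?thesis by linarith
qed

lemma len_S_mult_inv: "w \<in> carrier W \<Longrightarrow> s \<in> S \<Longrightarrow> len (s \<otimes> w) = len (inv w \<otimes> s)"
  by (metis S_closed S_inv inv_mult_group len_inv m_closed)

lemma len_S_mult: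
  assumes "w \<in> carrier W" "s \<in> S"
  shows "len (s \<otimes> w) = Suc (len w) \<or> len w = Suc (len (s \<otimes> w))"
  using len_mult_S[of "inv w" s] assms by (simp add: len_S_mult_inv)

lemma right_descent_ex:
  assumes "w \<in> carrier W" "w \<noteq> \<one>"
  obtains s where "s \<in> S" "len (w \<otimes> s) < len w"
proof -
  obtain u where u: "u \<in> lists S" "length u = len w" "wprod u = w"
    using reduced_word[OF assms(1)] .
  with assms have "u \<noteq> []" by auto
  then obtain v s where v: "u = v @ [s]" by (cases u rule: rev_cases) auto
  then have "w \<otimes> s = wprod v" using u by auto
  then show ?thesis using that[of s] len_wprod_le[of v] u v by auto
qed

lemma right_induct [consumes 1, case_names one mult]:
  assumes "w \<in> carrier W" "P \<one>"
    and step: "\<And>w s. \<lbrakk>w \<in> carrier W; s \<in> S; len (w \<otimes> s) = Suc (len w); P w\<rbrakk> \<Longrightarrow> P (w \<otimes> s)"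
  shows "P w"
  using assms(1)
proof (induction "len w" arbitrary: w rule: less_induct)
  case less
  show ?case
  proof (cases "w = \<one>")
    case False
    then obtain s where s: "s \<in> S" "len (w \<otimes> s) < len w"
      using less.prems right_descent_ex by blast
    then have "P (w \<otimes> s)" using less by simp
    with step[of "w \<otimes> s" s] s show ?thesis
      using less.prems len_mult_S[of w s] by auto
  qed (use assms in simp)
qed

lemma left_induct [consumes 1, case_names one mult]:
  assumes w: "w \<in> carrier W" and one: "P \<one>"
    and step: "\<And>w s. \<lbrakk>w \<in> carrier W; s \<in> S; len (s \<otimes> w) = Suc (len w); P w\<rbrakk> \<Longrightarrow> P (s \<otimes> w)"
  shows "P w"
proof -
  have "P (inv (inv w))"
  proof (rule right_induct[of "inv w" "\<lambda>w. P (inv w)"])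
    fix v s assume "v \<in> carrier W" "s \<in> S" "len (v \<otimes> s) = Suc (len v)" "P (inv v)"
    then show "P (inv (v \<otimes> s))"
      using step[of "inv v" s] by (simp add: len_S_mult_inv inv_mult_group)
  qed (use w one in auto)
  then show ?thesis using w by simp
qed

lemma reflsE:
  assumes "t \<in> refls"
  obtains w s where "w \<in> carrier W" "s \<in> S" "t = w \<otimes> s \<otimes> inv w"
  using assms unfolding reflections_def by blast

lemma refls_closed [simp]: "t \<in> refls \<Longrightarrow> t \<in> carrier W"
  by (erule reflsE) simp

lemma S_refls [simp]: "s \<in> S \<Longrightarrow> s \<in> refls"
  unfolding reflections_def by (auto intro!: exI[of _ \<one>] exI[of _ s])

lemma refls_conj: "t \<in> refls \<Longrightarrow> w \<in> carrier W \<Longrightarrow> w \<otimes> t \<otimes> inv w \<in> refls"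
proof (erule reflsE)
  fix v s assume "w \<in> carrier W" "v \<in> carrier W" "s \<in> S" "t = v \<otimes> s \<otimes> inv v"
  then have "w \<otimes> t \<otimes> inv w = (w \<otimes> v) \<otimes> s \<otimes> inv (w \<otimes> v)" "w \<otimes> v \<in> carrier W"
    by (simp_all add: inv_mult_group m_assoc)
  then show ?thesis unfolding reflections_def using \<open>s \<in> S\<close> by blast
qed

lemma refls_conj': "t \<in> refls \<Longrightarrow> w \<in> carrier W \<Longrightarrow> inv w \<otimes> t \<otimes> w \<in> refls"
  using refls_conj[of t "inv w"] by simp

lemma inv_cancel [simp]:
  "\<lbrakk>v \<in> carrier W; w \<in> carrier W\<rbrakk> \<Longrightarrow> inv v \<otimes> (v \<otimes> w) = w"
  "\<lbrakk>v \<in> carrier W; w \<in> carrier W\<rbrakk> \<Longrightarrow> v \<otimes> (inv v \<otimes> w) = w"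
  by (simp_all add: m_assoc[symmetric])

lemma refls_square: "t \<in> refls \<Longrightarrow> t \<otimes> t = \<one>"
  by (erule reflsE) (simp add: m_assoc)

lemma refls_cancel [simp]: "t \<in> refls \<Longrightarrow> w \<in> carrier W \<Longrightarrow> t \<otimes> (t \<otimes> w) = w"
  by (simp add: m_assoc[symmetric] refls_square)

lemma refls_inv [simp]: "t \<in> refls \<Longrightarrow> inv t = t"
  by (simp add: refls_square inv_equality)

text \<open>For \<open>t = w s inv w\<close> take the word \<open>p @ [s] @ rev p\<close> with
  \<open>p\<close> a word for \<open>w\<close>. The parts \<open>p\<close> and \<open>rev p\<close>
  contribute an even number together, since \<open>p @ rev p\<close> represents the unit, and the
  middle letter contributes one.\<close>

lemma refl_count_self:
  assumes "t \<in> refls" "u \<in> lists S" "wprod u = t"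
  shows "odd (refl_count u t)"
proof -
  obtain w s where w: "w \<in> carrier W" "s \<in> S" "t = w \<otimes> s \<otimes> inv w"
    using assms by (auto elim: reflsE)
  obtain p where p: "p \<in> lists S" "wprod p = w" using ex_word w by blast
  have rp: "rev p \<in> lists S" using p by auto
  have t: "inv w \<otimes> t \<otimes> w = s" using w by (simp add: m_assoc)
  have "even (refl_count (p @ rev p) t) = even (refl_count [] t)"
    using p rp assms w by (intro word_parity) (auto simp: wprod_rev)
  then have "even (refl_count p t + refl_count (rev p) s)"
    using p t assms by (simp add: refl_count_append)
  moreover have "even (refl_count (p @ [s] @ rev p) t) = even (refl_count u t)"
    using p rp assms w by (intro word_parity) (auto simp: wprod_rev m_assoc)
  moreover have "refl_count (p @ [s] @ rev p) t = refl_count p t + (1 + refl_count (rev p) s)"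
    using p t assms w by (simp add: refl_count_append)
  ultimately show ?thesis by auto
qed

text \<open>If \<open>t\<close> is the reflection that belongs to some position of \<open>u\<close>,
  multiplying by \<open>t\<close> from the left cancels exactly the letter there. The word need not
  be reduced.\<close>

lemma deletion:
  assumes "u \<in> lists S" "t \<in> carrier W" "refl_count u t \<noteq> 0"
  shows "\<exists>a s b. u = a @ s # b \<and> t \<otimes> wprod u = wprod (a @ b)"
  using assms
proof (induction u arbitrary: t)
  case (Cons s u)
  have s: "s \<in> S" "u \<in> lists S" using Cons.hyps by auto
  show ?case
  proof (cases "t = s")
    case True
    then have "s # u = [] @ s # u \<and> t \<otimes> wprod (s # u) = wprod ([] @ u)"
      using s by simp
    then show ?thesis by blast
  next
    case False
    obtain a r b where ab: "u = a @ r # b" "s \<otimes> t \<otimes> s \<otimes> wprod u = wprod (a @ b)"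
      using s Cons.IH[of "s \<otimes> t \<otimes> s"] Cons.prems False by auto
    have "t \<otimes> wprod (s # u) = s \<otimes> (s \<otimes> t \<otimes> s \<otimes> wprod u)"
      using s Cons.prems by (simp add: m_assoc)
    then have "t \<otimes> wprod (s # u) = wprod ((s # a) @ b)" using ab by simp
    then show ?thesis using ab(1) by (metis append_Cons)
  qed
qed simp

text \<open>Prepend a word for \<open>t\<close>: it has an odd count of \<open>t\<close>, and
  conjugation by \<open>t\<close> fixes \<open>t\<close>, so the count in \<open>u\<close> is merely
  shifted by an odd number.\<close>

lemma refl_count_mult:
  assumes "t \<in> refls" "u \<in> lists S" "v \<in> lists S" "wprod v = t \<otimes> wprod u"
  shows "even (refl_count v t) \<longleftrightarrow> odd (refl_count u t)"
proof -
  obtain p where p: "p \<in> lists S" "wprod p = t" using ex_word[of t] assms by auto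
  have "even (refl_count (p @ u) t) = even (refl_count v t)"
    using p assms by (intro word_parity) auto
  moreover have "refl_count (p @ u) t = refl_count p t + refl_count u t"
    using p assms by (simp add: refl_count_append m_assoc refls_square)
  moreover have "odd (refl_count p t)" using refl_count_self assms p by blast
  ultimately show ?thesis by auto
qed

lemma odd_refl_count_less:
  assumes "t \<in> refls" "u \<in> lists S" "odd (refl_count u t)"
  shows "len (t \<otimes> wprod u) < len (wprod u)"
proof -
  obtain v where v: "v \<in> lists S" "length v = len (wprod u)" "wprod v = wprod u"
    using reduced_word[of "wprod u"] assms by auto
  then have "odd (refl_count v t)" using word_parity(2)[of u v t] assms by auto
  then have "refl_count v t \<noteq> 0" by (rule contrapos_nn) simp
  from deletion[OF v(1) refls_closed[OF assms(1)] this]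
  obtain a s b where ab: "v = a @ s # b" "t \<otimes> wprod v = wprod (a @ b)" by blast
  with len_wprod_le[of "a @ b"] v show ?thesis by auto
qed

text \<open>An odd count lets a letter be deleted from a reduced word. If the count is even, it is
  odd for \<open>t \<otimes> wprod u\<close>, and then multiplication by \<open>t\<close> lengthens
  \<open>wprod u\<close>.\<close>

lemma len_refl_less_iff:
  assumes "t \<in> refls" "u \<in> lists S"
  shows "len (t \<otimes> wprod u) < len (wprod u) \<longleftrightarrow> odd (refl_count u t)"
proof
  assume less: "len (t \<otimes> wprod u) < len (wprod u)"
  show "odd (refl_count u t)"
  proof (rule ccontr)
    assume even: "\<not> odd (refl_count u t)"
    obtain v where v: "v \<in> lists S" "wprod v = t \<otimes> wprod u"
      using ex_word[of "t \<otimes> wprod u"] assms by auto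
    then have "odd (refl_count v t)" using refl_count_mult[of t u v] assms even by auto
    from odd_refl_count_less[OF assms(1) v(1) this] less show False
      using v assms by simp
  qed
qed (rule odd_refl_count_less[OF assms])

lemma len_refl_neq:
  assumes "t \<in> refls" "w \<in> carrier W"
  shows "len (t \<otimes> w) \<noteq> len w"
proof -
  obtain u where u: "u \<in> lists S" "wprod u = w" using ex_word assms by blast
  obtain v where v: "v \<in> lists S" "wprod v = t \<otimes> w" using ex_word[of "t \<otimes> w"] assms by auto
  have "t \<otimes> wprod v = w" using v assms by simp
  then have "len w < len (t \<otimes> w) \<longleftrightarrow> odd (refl_count v t)"
    using len_refl_less_iff[OF assms(1) v(1)] v(2) by simp
  moreover have "len (t \<otimes> w) < len w \<longleftrightarrow> odd (refl_count u t)"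
    using len_refl_less_iff[OF assms(1) u(1)] u(2) by simp
  moreover have "even (refl_count v t) \<longleftrightarrow> odd (refl_count u t)"
    using refl_count_mult[OF assms(1) u(1) v(1)] u v by simp
  ultimately show ?thesis by auto
qed

lemma strong_exchange:
  assumes "t \<in> refls" "u \<in> lists S" "len (t \<otimes> wprod u) < len (wprod u)"
  shows "\<exists>a s b. u = a @ s # b \<and> t \<otimes> wprod u = wprod (a @ b)"
proof (rule deletion)
  show "refl_count u t \<noteq> 0" using len_refl_less_iff[of t u] assms by (metis even_zero)
qed (use assms in auto)

text \<open>Exchange in the word \<open>u @ [s]\<close> with \<open>u\<close> reduced for
  \<open>w\<close> must delete the final \<open>s\<close>. Deleting a letter of \<open>u\<close>
  would give a word for \<open>r \<otimes> w\<close> shorter than \<open>u\<close>, although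
  \<open>r\<close> lengthens \<open>w\<close>.\<close>

lemma refl_mult_eq_mult_S:
  assumes "r \<in> refls" "s \<in> S" "w \<in> carrier W"
    and less: "len w < len (r \<otimes> w)" "len (r \<otimes> w \<otimes> s) < len (w \<otimes> s)"
  shows "r \<otimes> w = w \<otimes> s"
proof -
  obtain u where u: "u \<in> lists S" "length u = len w" "wprod u = w"
    using reduced_word assms by blast
  have us: "u @ [s] \<in> lists S" "wprod (u @ [s]) = w \<otimes> s" using u assms by auto
  then obtain a q b where ab: "u @ [s] = a @ q # b" "r \<otimes> (w \<otimes> s) = wprod (a @ b)"
    using strong_exchange[of r "u @ [s]"] assms by (auto simp: m_assoc)
  show ?thesis
  proof (cases b rule: rev_cases)
    case Nil
    then have "r \<otimes> (w \<otimes> s) = w" using ab u by auto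
    then show ?thesis using assms
      by (metis S_cancel(2) S_closed m_assoc m_closed refls_closed)
  next
    case (snoc b' s')
    then have *: "u = a @ q # b'" "s' = s" using ab by auto
    then have abl: "a @ b' \<in> lists S" using u by auto
    then have "r \<otimes> w \<otimes> s = wprod (a @ b') \<otimes> s"
      using ab snoc * assms by (auto simp: m_assoc)
    then have "r \<otimes> w = wprod (a @ b')"
      using assms abl by (metis S_closed m_closed refls_closed right_cancel wprod_closed)
    then have "len (r \<otimes> w) < len w" using len_wprod_le[OF abl] u * by simp
    with less show ?thesis by simp
  qed
qed

text \<open>The reflection \<open>r = a s inv a\<close> has an even count in a word for
  \<open>a\<close>, as it lengthens \<open>a\<close>. Conjugated by \<open>a\<close> it becomes
  \<open>s\<close>, whose count in a word for \<open>g\<close> is odd. So \<open>r\<close> shortens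
  \<open>a \<otimes> g\<close>.\<close>

lemma len_cancel_S:
  assumes "s \<in> S" "a \<in> carrier W" "g \<in> carrier W"
    and "len a < len (a \<otimes> s)" "len (s \<otimes> g) < len g"
  shows "len (a \<otimes> s \<otimes> g) < len (a \<otimes> g)"
proof -
  define r where "r = a \<otimes> s \<otimes> inv a"
  have r: "r \<in> refls" unfolding r_def using assms refls_conj by simp
  obtain u where u: "u \<in> lists S" "wprod u = a" using ex_word assms by blast
  obtain v where v: "v \<in> lists S" "wprod v = g" using ex_word assms by blast
  have ras: "r \<otimes> a = a \<otimes> s" using assms by (simp add: r_def m_assoc)
  have "\<not> len (r \<otimes> wprod u) < len (wprod u)"
    using assms u by (simp add: ras)
  then have "even (refl_count u r)" using len_refl_less_iff r u by blast
  moreover have "odd (refl_count v s)"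
    using len_refl_less_iff[of s v] assms v by simp
  moreover have "inv a \<otimes> r \<otimes> a = s" using assms by (simp add: r_def m_assoc)
  ultimately have "odd (refl_count (u @ v) r)"
    using u v r by (simp add: refl_count_append)
  then have "len (r \<otimes> wprod (u @ v)) < len (wprod (u @ v))"
    using len_refl_less_iff[of r "u @ v"] r u v by simp
  then show ?thesis using u v assms ras r by (simp add: m_assoc[symmetric])
qed

subsection \<open>Bruhat order\<close>

abbreviation ble :: "'a \<Rightarrow> 'a \<Rightarrow> bool" (infix \<open>\<preceq>\<close> 50) where
  "u \<preceq> v \<equiv> bruhat_le W S u v"

lemma ble_closed: "u \<preceq> v \<Longrightarrow> u \<in> carrier W" "u \<preceq> v \<Longrightarrow> v \<in> carrier W"
  by (simp_all add: bruhat_le_def)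

lemma ble_refl [simp]: "u \<in> carrier W \<Longrightarrow> u \<preceq> u"
  by (simp add: bruhat_le_def)

lemma ble_trans [trans]: "u \<preceq> v \<Longrightarrow> v \<preceq> w \<Longrightarrow> u \<preceq> w"
  unfolding bruhat_le_def by (blast intro: rtrancl_trans)

lemma ble_refl_mult:
  assumes "w \<in> carrier W" "r \<in> refls" "len w < len (r \<otimes> w)"
  shows "w \<preceq> r \<otimes> w"
proof -
  define t where "t = inv w \<otimes> r \<otimes> w"
  have t: "t \<in> refls" unfolding t_def using assms refls_conj' by simp
  have "r \<otimes> w = w \<otimes> t" using assms by (simp add: t_def m_assoc)
  with t assms show ?thesis unfolding bruhat_le_def by auto
qed

text \<open>The order is defined with reflections on the right, while the exchange results above
  multiply on the left. Conjugating the reflection by \<open>w\<close> passes between the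
  two.\<close>

lemma ble_induct [consumes 1, case_names refl step]:
  assumes "u \<preceq> v" "u \<in> carrier W \<Longrightarrow> P u"
    and step: "\<And>w r. \<lbrakk>w \<in> carrier W; r \<in> refls; len w < len (r \<otimes> w); u \<preceq> w; P w\<rbrakk> \<Longrightarrow> P (r \<otimes> w)"
  shows "P v"
proof -
  let ?E = "{(w, w \<otimes> t) | w t. w \<in> carrier W \<and> t \<in> refls \<and> len w < len (w \<otimes> t)}"
  have "(u, v) \<in> ?E\<^sup>*" and u: "u \<in> carrier W" using assms(1) by (auto simp: bruhat_le_def)
  from this(1) have "P v \<and> u \<preceq> v"
  proof (induction rule: rtrancl_induct)
    case base
    then show ?case using u assms(2) by simp
  next
    case (step y z)
    then obtain t where t: "y \<in> carrier W" "t \<in> refls" "len y < len (y \<otimes> t)" "z = y \<otimes> t" by auto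
    have z: "z = (y \<otimes> t \<otimes> inv y) \<otimes> y" using t by (simp add: m_assoc)
    have r: "y \<otimes> t \<otimes> inv y \<in> refls" using t refls_conj by simp
    from assms(3)[of y "y \<otimes> t \<otimes> inv y"] have "P z"
      using step.IH t z r by simp
    moreover have "y \<preceq> z"
      using ble_refl_mult[of y "y \<otimes> t \<otimes> inv y"] t z r by simp
    ultimately show ?case using step.IH ble_trans by blast
  qed
  then show ?thesis by simp
qed

lemma ble_len: "u \<preceq> v \<Longrightarrow> len u \<le> len v"
  by (induction rule: ble_induct) auto

lemma ble_one: "u \<preceq> \<one> \<Longrightarrow> u = \<one>"
  using ble_len[of u \<one>] len_eq_0[of u] ble_closed[of u \<one>] by simp

lemma ble_mult_refl:
  assumes "w \<in> carrier W" "t \<in> refls" "len w < len (w \<otimes> t)"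
  shows "w \<preceq> w \<otimes> t"
  using assms unfolding bruhat_le_def by auto

lemma ble_inv: "u \<preceq> v \<Longrightarrow> inv u \<preceq> inv v"
proof (induction rule: ble_induct)
  case refl
  then show ?case using ble_closed by simp
next
  case (step w r)
  have "inv (r \<otimes> w) = inv w \<otimes> r" using step by (simp add: inv_mult_group)
  moreover have "len (inv (r \<otimes> w)) = len (r \<otimes> w)" using step by (intro len_inv) simp
  ultimately have "inv w \<preceq> inv (r \<otimes> w)"
    using ble_mult_refl[of "inv w" r] step by simp
  with step show ?case using ble_trans by blast
qed

text \<open>The Demazure product with a single generator. It is available before the product itself
  is known to exist and serves to construct it.\<close>

definition dem_right :: "'a \<Rightarrow> 'a \<Rightarrow> 'a" where
  "dem_right w s = (if len w < len (w \<otimes> s) then w \<otimes> s else w)"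

definition dem_left :: "'a \<Rightarrow> 'a \<Rightarrow> 'a" where
  "dem_left s w = (if len w < len (s \<otimes> w) then s \<otimes> w else w)"

lemma dem_right_closed [simp]: "w \<in> carrier W \<Longrightarrow> s \<in> S \<Longrightarrow> dem_right w s \<in> carrier W"
  and dem_left_closed [simp]: "w \<in> carrier W \<Longrightarrow> s \<in> S \<Longrightarrow> dem_left s w \<in> carrier W"
  by (simp_all add: dem_right_def dem_left_def)

lemma dem_left_inv:
  "w \<in> carrier W \<Longrightarrow> s \<in> S \<Longrightarrow> dem_left s w = inv (dem_right (inv w) s)"
  by (simp add: dem_right_def dem_left_def len_S_mult_inv inv_mult_group)

lemma ble_dem_right:
  assumes "w \<in> carrier W" "s \<in> S"
  shows "w \<preceq> dem_right w s" "w \<otimes> s \<preceq> dem_right w s"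
proof -
  show "w \<preceq> dem_right w s"
    using assms by (simp add: dem_right_def ble_mult_refl)
  show "w \<otimes> s \<preceq> dem_right w s"
    using assms len_mult_S[OF assms] ble_mult_refl[of "w \<otimes> s" s]
    by (auto simp: dem_right_def)
qed

lemma ble_dem_left:
  assumes "w \<in> carrier W" "s \<in> S"
  shows "w \<preceq> dem_left s w" "s \<otimes> w \<preceq> dem_left s w"
  using ble_dem_right[of "inv w" s, THEN ble_inv] assms
  by (simp_all add: dem_left_inv inv_mult_group)

text \<open>Right multiplication by \<open>s\<close> keeps the direction of a Bruhat edge, the only
  exception being the edge from \<open>w\<close> to \<open>w \<otimes> s\<close>, which it
  reverses.\<close>

lemma refl_edge_mult_S:
  assumes "w \<in> carrier W" "r \<in> refls" "len w < len (r \<otimes> w)" "s \<in> S"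
  shows "r \<otimes> w = w \<otimes> s \<or> w \<otimes> s \<preceq> r \<otimes> w \<otimes> s"
proof (cases "len (r \<otimes> w \<otimes> s) < len (w \<otimes> s)")
  case True
  then show ?thesis using refl_mult_eq_mult_S assms by blast
next
  case False
  with len_refl_neq[of r "w \<otimes> s"] assms have "len (w \<otimes> s) < len (r \<otimes> (w \<otimes> s))"
    by (simp add: m_assoc)
  with ble_refl_mult[of "w \<otimes> s" r] assms show ?thesis by (simp add: m_assoc)
qed

lemma dem_right_mono:
  assumes "u \<preceq> v" "s \<in> S"
  shows "dem_right u s \<preceq> dem_right v s"
  using assms(1)
proof (induction rule: ble_induct)
  case refl
  then show ?case using assms ble_closed by simp
next
  case (step w r)
  have rw: "r \<otimes> w \<in> carrier W" using step by simp
  have "dem_right w s \<preceq> dem_right (r \<otimes> w) s"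
  proof (cases "len w < len (w \<otimes> s)")
    case True
    then show ?thesis
      using refl_edge_mult_S[of w r s] step assms(2) rw ble_dem_right[of "r \<otimes> w" s]
      by (metis ble_trans dem_right_def)
  next
    case False
    then show ?thesis
      using ble_refl_mult[of w r] ble_dem_right[of "r \<otimes> w" s] step assms(2) rw
      by (metis ble_trans dem_right_def)
  qed
  with step show ?case using ble_trans by blast
qed

lemma dem_left_mono:
  assumes "u \<preceq> v" "s \<in> S"
  shows "dem_left s u \<preceq> dem_left s v"
  using dem_right_mono[OF ble_inv[OF assms(1)] assms(2), THEN ble_inv] assms ble_closed[OF assms(1)]
  by (simp add: dem_left_inv)

lemma lifting_right:
  assumes "u \<preceq> v" "s \<in> S" "len u < len (u \<otimes> s)" "len (v \<otimes> s) < len v"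
  shows "u \<preceq> v \<otimes> s"
proof -
  \<comment> \<open>\<open>dn w\<close> is the shorter of \<open>w\<close> and
    \<open>w \<otimes> s\<close>. The lifting property is the monotonicity of this map, checked on
    single edges.\<close>
  define dn where "dn w = (if len (w \<otimes> s) < len w then w \<otimes> s else w)" for w
  have dn_le: "dn w \<preceq> w" "dn w \<preceq> w \<otimes> s" if "w \<in> carrier W" for w
    using that assms(2) ble_mult_refl[of w s] ble_mult_refl[of "w \<otimes> s" s] len_mult_S[of w s]
    by (auto simp: dn_def)
  have "dn u \<preceq> dn v"
    using assms(1)
  proof (induction rule: ble_induct)
    case refl
    then show ?case using assms ble_closed by (simp add: dn_def)
  next
    case (step w r)
    have rw: "r \<otimes> w \<in> carrier W" using step by simp
    have "dn w \<preceq> dn (r \<otimes> w)"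
    proof (cases "len (r \<otimes> w \<otimes> s) < len (r \<otimes> w)")
      case True
      then have dn: "dn (r \<otimes> w) = r \<otimes> w \<otimes> s" by (simp add: dn_def)
      show ?thesis
      proof (cases "r \<otimes> w = w \<otimes> s")
        case True
        then have "r \<otimes> w \<otimes> s = w" using step assms(2) by simp
        then show ?thesis using dn dn_le(1)[of w] step by simp
      next
        case False
        then show ?thesis
          using refl_edge_mult_S[of w r s] step assms(2) dn dn_le(2)[of w]
          by (metis ble_trans)
      qed
    next
      case False
      then have "dn (r \<otimes> w) = r \<otimes> w" by (simp add: dn_def)
      then show ?thesis
        using ble_refl_mult[of w r] dn_le(1)[of w] step by (metis ble_trans)
    qed
    with step show ?case using ble_trans by blast
  qed
  then show ?thesis using assms by (simp add: dn_def)
qed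

lemma ble_dem_right_imp:
  assumes "u \<preceq> dem_right v s" "s \<in> S" "v \<in> carrier W" "len u < len (u \<otimes> s)"
  shows "u \<preceq> v"
  using assms lifting_right[of u "v \<otimes> s" s] by (auto simp: dem_right_def split: if_splits)

lemma ble_dem_left_imp:
  assumes "u \<preceq> dem_left s v" "s \<in> S" "v \<in> carrier W" "len u < len (s \<otimes> u)"
  shows "u \<preceq> v"
proof -
  have "u \<in> carrier W" using assms ble_closed by blast
  moreover from this have "inv u \<preceq> inv v"
    using ble_inv[OF assms(1)] assms
    by (intro ble_dem_right_imp[of "inv u" "inv v" s]) (simp_all add: dem_left_inv len_S_mult_inv)
  ultimately show ?thesis using ble_inv[of "inv u" "inv v"] assms by simp
qed

subsection \<open>Demazure product\<close>

text \<open>Comparing lengths settles all cases but one: both \<open>s\<close> and \<open>t\<close>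
  lengthen \<open>w\<close>, yet \<open>s w t\<close> is shorter than \<open>w t\<close>. Then
  exchange gives \<open>s w = w t\<close>, and both sides equal this element.\<close>

lemma dem_left_right_commute:
  assumes "w \<in> carrier W" "s \<in> S" "t \<in> S"
  shows "dem_left s (dem_right w t) = dem_right (dem_left s w) t"
proof -
  have assoc: "s \<otimes> (w \<otimes> t) = s \<otimes> w \<otimes> t" using assms by (simp add: m_assoc)
  have eq: "s \<otimes> w = w \<otimes> t"
    if "len w < len (s \<otimes> w)" "len (s \<otimes> w \<otimes> t) < len (w \<otimes> t)"
    using refl_mult_eq_mult_S[of s t w] assms that by simp
  note lens = len_mult_S[of w t] len_S_mult[of w s] len_mult_S[of "s \<otimes> w" t]
    len_S_mult[of "w \<otimes> t" s]
  show ?thesis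
  proof (cases "len w < len (s \<otimes> w) \<and> len w < len (w \<otimes> t)")
    case True
    show ?thesis
    proof (cases "len (s \<otimes> w \<otimes> t) < len (w \<otimes> t)")
      case less: True
      then have "s \<otimes> w = w \<otimes> t" using eq True by simp
      then show ?thesis
        using True less by (auto simp: dem_left_def dem_right_def assoc)
    next
      case False
      then show ?thesis
        using True lens assms by (auto simp: dem_left_def dem_right_def assoc)
    qed
  next
    case False
    then show ?thesis
      using lens assms by (auto simp: dem_left_def dem_right_def assoc)
  qed
qed

abbreviation dem_fold :: "'a \<Rightarrow> 'a list \<Rightarrow> 'a" where "dem_fold \<equiv> foldl dem_right"

lemma dem_fold_closed [simp]: "w \<in> carrier W \<Longrightarrow> u \<in> lists S \<Longrightarrow> dem_fold w u \<in> carrier W"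
  by (induction u arbitrary: w rule: list.induct) auto

lemma dem_left_fold:
  "\<lbrakk>w \<in> carrier W; s \<in> S; u \<in> lists S\<rbrakk> \<Longrightarrow> dem_left s (dem_fold w u) = dem_fold (dem_left s w) u"
  by (induction u arbitrary: w rule: list.induct) (auto simp: dem_left_right_commute)

lemma ex_dem_fold: "w \<in> carrier W \<Longrightarrow> \<exists>u \<in> lists S. dem_fold \<one> u = w"
proof (induction rule: right_induct)
  case one
  show ?case by (intro bexI[of _ "[]"]) auto
next
  case (mult w s)
  then obtain u where "u \<in> lists S" "dem_fold \<one> u = w" by blast
  moreover have "dem_right w s = w \<otimes> s" using mult by (simp add: dem_right_def)
  ultimately show ?case using mult by (intro bexI[of _ "u @ [s]"]) auto
qed

text \<open>
  The operators \<open>dem_fold _ u\<close> commute with all \<open>dem_left s\<close>, hence are determined by their value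
  at the unit. This makes the product below well defined and associative.
\<close>
lemma dem_fold_cong:
  assumes "w \<in> carrier W" "u \<in> lists S" "v \<in> lists S" "dem_fold \<one> u = dem_fold \<one> v"
  shows "dem_fold w u = dem_fold w v"
  using assms(1)
proof (induction rule: left_induct)
  case (mult w s)
  then have "s \<otimes> w = dem_left s w" by (simp add: dem_left_def)
  then show ?case using mult assms dem_left_fold by metis
qed (use assms in simp)

text \<open>The chosen word must yield \<open>y\<close> by Demazure steps from the unit, not by
  multiplication; it may be unreduced.\<close>

definition dem_prod :: "'a \<Rightarrow> 'a \<Rightarrow> 'a" where
  "dem_prod x y = (if x \<in> carrier W \<and> y \<in> carrier W
     then dem_fold x (SOME u. u \<in> lists S \<and> dem_fold \<one> u = y) else undefined)"

lemma dem_prod_fold: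
  assumes "x \<in> carrier W" "u \<in> lists S" "dem_fold \<one> u = y"
  shows "dem_prod x y = dem_fold x u"
proof -
  let ?v = "SOME u. u \<in> lists S \<and> dem_fold \<one> u = y"
  have "?v \<in> lists S \<and> dem_fold \<one> ?v = y"
    by (rule someI[of _ u]) (use assms in simp)
  moreover have "y \<in> carrier W" using assms by auto
  ultimately show ?thesis
    using dem_fold_cong[of x ?v u] assms by (simp add: dem_prod_def)
qed

lemma dem_right_one: "s \<in> S \<Longrightarrow> dem_right \<one> s = s"
  and dem_left_one: "s \<in> S \<Longrightarrow> dem_left s \<one> = s"
  using len_mult_S[of \<one> s] by (auto simp: dem_right_def dem_left_def)

lemma is_demazure_product_dem_prod: "is_demazure_product W S dem_prod"
  unfolding is_demazure_product_def
proof (intro conjI ballI allI impI)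
  fix x y assume xy: "x \<in> carrier W" "y \<in> carrier W"
  then obtain u where u: "u \<in> lists S" "dem_fold \<one> u = y" using ex_dem_fold by blast
  show "dem_prod x y \<in> carrier W" using dem_prod_fold[of x u y] xy u by simp
  fix z assume "z \<in> carrier W"
  then obtain v where v: "v \<in> lists S" "dem_fold \<one> v = z" using ex_dem_fold by blast
  \<comment> \<open>If \<open>u\<close> folds to \<open>y\<close> and \<open>v\<close> to
    \<open>z\<close>, then \<open>u @ v\<close> folds to the product of \<open>y\<close> and
    \<open>z\<close>. Associativity is thus concatenation of words.\<close>
  have "dem_prod y z = dem_fold \<one> (u @ v)"
    using dem_prod_fold[of y v z] u v xy by simp
  moreover have "dem_prod (dem_prod x y) z = dem_fold x (u @ v)"
    using dem_prod_fold[of x u y] dem_prod_fold[of "dem_fold x u" v z] u v xy by simp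
  ultimately show "dem_prod (dem_prod x y) z = dem_prod x (dem_prod y z)"
    using dem_prod_fold[of x "u @ v" "dem_prod y z"] u v xy by simp
next
  fix w assume w: "w \<in> carrier W"
  then obtain u where u: "u \<in> lists S" "dem_fold \<one> u = w" using ex_dem_fold by blast
  show "dem_prod \<one> w = w" using dem_prod_fold[of \<one> u w] u by simp
  show "dem_prod w \<one> = w" using dem_prod_fold[of w "[]" \<one>] w by simp
  fix s assume s: "s \<in> S"
  have "dem_prod s w = dem_fold (dem_left s \<one>) u"
    using dem_prod_fold[of s u w] u s by (simp add: dem_left_one)
  also have "\<dots> = dem_left s w"
    using dem_left_fold[of \<one> s u] u s by simp
  finally show "dem_prod s w = (if len (s \<otimes> w) > len w then s \<otimes> w else w)"
    by (simp add: dem_left_def)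
  show "dem_prod w s = (if len (w \<otimes> s) > len w then w \<otimes> s else w)"
    using dem_prod_fold[of w "[s]" s] w s dem_right_one by (simp add: dem_right_def)
next
  fix x y assume "x \<notin> carrier W \<or> y \<notin> carrier W"
  then show "dem_prod x y = undefined" by (auto simp: dem_prod_def)
qed

lemma demazure_product_mult_S:
  assumes "is_demazure_product W S d" "x \<in> carrier W" "w \<in> carrier W" "s \<in> S"
    and "len w < len (w \<otimes> s)"
  shows "d x (w \<otimes> s) = dem_right (d x w) s"
proof -
  note A = assms(1)[unfolded is_demazure_product_def]
  have "d w s = w \<otimes> s" "d x w \<in> carrier W" using A assms by simp_all
  moreover have "d (d x w) s = d x (d w s)"
    using A assms(2,3) S_closed[OF assms(4)] by blast
  moreover have "d (d x w) s = dem_right (d x w) s"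
    using A assms(4) \<open>d x w \<in> carrier W\<close> by (simp add: dem_right_def)
  ultimately show ?thesis by simp
qed

text \<open>Associativity and the rule for a single generator determine the second argument letter
  by letter along a reduced word; the unit condition starts the induction.\<close>

lemma demazure_product_unique:
  assumes "is_demazure_product W S d" "is_demazure_product W S d'"
  shows "d = d'"
proof (intro ext)
  fix x y
  note A = assms[unfolded is_demazure_product_def]
  show "d x y = d' x y"
  proof (cases "x \<in> carrier W \<and> y \<in> carrier W")
    case True
    then have x: "x \<in> carrier W" and "y \<in> carrier W" by auto
    from this(2) show ?thesis
    proof (induction rule: right_induct)
      case (mult w s)
      then show ?case
        using demazure_product_mult_S[OF assms(1) x, of w s]
          demazure_product_mult_S[OF assms(2) x, of w s] by simp
    qed (use A x in auto)
  next
    case False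
    then show ?thesis using A by metis
  qed
qed

lemma is_demazure_product_demazure: "is_demazure_product W S (demazure W S)"
  unfolding demazure_def
  using is_demazure_product_dem_prod demazure_product_unique by (metis theI)

abbreviation dem :: "'a \<Rightarrow> 'a \<Rightarrow> 'a" (infixl \<open>\<odot>\<close> 70) where "x \<odot> y \<equiv> demazure W S x y"

lemmas demD = is_demazure_product_demazure[unfolded is_demazure_product_def]

lemma dem_closed [simp]: "\<lbrakk>x \<in> carrier W; y \<in> carrier W\<rbrakk> \<Longrightarrow> x \<odot> y \<in> carrier W"
  and dem_assoc: "\<lbrakk>x \<in> carrier W; y \<in> carrier W; z \<in> carrier W\<rbrakk> \<Longrightarrow> x \<odot> y \<odot> z = x \<odot> (y \<odot> z)"
  and dem_one [simp]: "x \<in> carrier W \<Longrightarrow> \<one> \<odot> x = x" "x \<in> carrier W \<Longrightarrow> x \<odot> \<one> = x"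
  and dem_S_left: "\<lbrakk>s \<in> S; x \<in> carrier W\<rbrakk> \<Longrightarrow> s \<odot> x = dem_left s x"
  and dem_S_right: "\<lbrakk>s \<in> S; x \<in> carrier W\<rbrakk> \<Longrightarrow> x \<odot> s = dem_right x s"
  using demD by (simp_all add: dem_left_def dem_right_def)

lemma S_mult_dem:
  assumes "s \<in> S" "u \<in> carrier W" "v \<in> carrier W" "len u < len (s \<otimes> u)"
  shows "s \<otimes> u \<odot> v = dem_left s (u \<odot> v)"
proof -
  have "s \<otimes> u \<odot> v = s \<odot> u \<odot> v" using assms by (simp add: dem_S_left dem_left_def)
  also have "\<dots> = s \<odot> (u \<odot> v)" using assms by (intro dem_assoc) auto
  also have "\<dots> = dem_left s (u \<odot> v)" using assms by (simp add: dem_S_left)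
  finally show ?thesis .
qed

lemma dem_mono_right:
  assumes "u \<in> carrier W" "v \<preceq> w"
  shows "u \<odot> v \<preceq> u \<odot> w"
  using assms(1)
proof (induction rule: left_induct)
  case one
  then show ?case using assms(2) ble_closed[OF assms(2)] by simp
next
  case (mult u s)
  then show ?case
    using dem_left_mono[of "u \<odot> v" "u \<odot> w" s] ble_closed[OF assms(2)]
    by (simp add: S_mult_dem)
qed

lemma mult_ble_dem:
  assumes "u \<in> carrier W" "v \<in> carrier W"
  shows "u \<otimes> v \<preceq> u \<odot> v"
  using assms(1)
proof (induction rule: left_induct)
  case (mult u s)
  then have "s \<otimes> u \<otimes> v \<preceq> dem_left s (u \<otimes> v)"
    using ble_dem_left(2)[of "u \<otimes> v" s] assms by (simp add: m_assoc)
  also have "dem_left s (u \<otimes> v) \<preceq> dem_left s (u \<odot> v)"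
    using mult by (intro dem_left_mono)
  also have "dem_left s (u \<odot> v) = s \<otimes> u \<odot> v"
    using mult assms by (simp add: S_mult_dem)
  finally show ?case .
qed (use assms in simp)

text \<open>Induction on the letters of \<open>a\<close>. A letter that lengthens the product
  cancels against its inverse; an absorbed letter only moves the left side down a Bruhat
  edge.\<close>

lemma inv_mult_dem_ble:
  assumes "a \<in> carrier W" "b \<in> carrier W"
  shows "inv a \<otimes> (a \<odot> b) \<preceq> b"
  using assms(1)
proof (induction rule: left_induct)
  case (mult a s)
  define g where "g = a \<odot> b"
  have g: "g \<in> carrier W" using mult assms by (simp add: g_def)
  have sab: "s \<otimes> a \<odot> b = dem_left s g"
    using mult assms by (simp add: g_def S_mult_dem)
  show ?case
  proof (cases "len g < len (s \<otimes> g)")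
    case True
    then have "inv (s \<otimes> a) \<otimes> (s \<otimes> a \<odot> b) = inv a \<otimes> g"
      using mult g by (simp add: sab dem_left_def inv_mult_group m_assoc)
    then show ?thesis using mult by (simp add: g_def)
  next
    case False
    \<comment> \<open>Here \<open>s\<close> is absorbed by \<open>g\<close>. The new left side
      \<open>h\<close> differs from the old one, \<open>inv a \<otimes> g\<close>, by the reflection
      \<open>r\<close>, and \<open>len_cancel_S\<close> shows that it is shorter.\<close>
    define r where "r = inv a \<otimes> s \<otimes> a"
    have r: "r \<in> refls" using refls_conj'[of s a] mult by (simp add: r_def)
    define h where "h = inv a \<otimes> s \<otimes> g"
    have h: "h \<in> carrier W" "inv (s \<otimes> a) \<otimes> (s \<otimes> a \<odot> b) = h"
      using mult g False by (simp_all add: h_def sab dem_left_def inv_mult_group)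
    have rh: "r \<otimes> h = inv a \<otimes> g" using mult g by (simp add: r_def h_def m_assoc)
    have "len (s \<otimes> g) < len g" using False len_S_mult[of g s] mult g by auto
    moreover have "len (inv a) < len (inv a \<otimes> s)"
      using mult len_S_mult_inv[of a s] by simp
    ultimately have "len h < len (inv a \<otimes> g)"
      unfolding h_def using mult g by (intro len_cancel_S) auto
    then have "h \<preceq> inv a \<otimes> g" using ble_refl_mult[of h r] h r rh by simp
    also have "inv a \<otimes> g \<preceq> b" using mult by (simp add: g_def)
    finally show ?thesis by (simp add: h)
  qed
qed (use assms in simp)

end

subsection \<open>Twisted involutions\<close>

context twisted_coxeter_system
begin

abbreviation tinv :: "'a set" where "tinv \<equiv> twisted_involutions W star"
abbreviation hlen :: "'a \<Rightarrow> nat" where "hlen \<equiv> inv_length W S star"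
abbreviation tdc :: "'a \<Rightarrow> 'a \<Rightarrow> 'a" (infixl \<open>\<ltimes>\<close> 70) where
  "x \<ltimes> w \<equiv> twisted_dem_conj W S star x w"

lemma star_hom: "star \<in> hom W W"
  using star_automorphism by (simp add: iso_def)

lemma star_closed [simp]: "w \<in> carrier W \<Longrightarrow> star w \<in> carrier W"
  using star_hom by (rule hom_in_carrier)

lemma star_mult [simp]: "\<lbrakk>v \<in> carrier W; w \<in> carrier W\<rbrakk> \<Longrightarrow> star (v \<otimes> w) = star v \<otimes> star w"
  using star_hom by (rule hom_mult)

lemma star_one [simp]: "star \<one> = \<one>"
  using star_hom by (rule hom_one) (rule is_group)+

lemma star_in_S [simp]: "s \<in> S \<Longrightarrow> star s \<in> S"
  using star_S by blast

lemma len_star [simp]: "w \<in> carrier W \<Longrightarrow> len (star w) = len w"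
proof -
  have le: "len (star w) \<le> len w" if w: "w \<in> carrier W" for w
  proof -
    obtain u where u: "u \<in> lists S" "length u = len w" "wprod u = w"
      using reduced_word[OF w] .
    have "map star u \<in> lists S" using u(1) by (induction u) auto
    moreover have "wprod (map star u) = star (wprod u)" using u(1) by (induction u) auto
    ultimately show ?thesis using len_wprod_le[of "map star u"] u by simp
  qed
  assume "w \<in> carrier W"
  with le[of w] le[of "star w"] show ?thesis by (simp add: star_star)
qed

lemma tinvD: "x \<in> tinv \<Longrightarrow> x \<in> carrier W" "x \<in> tinv \<Longrightarrow> inv x = star x"
  by (simp_all add: twisted_involutions_def)

lemma len_star_mult_tinv:
  assumes "x \<in> tinv" "s \<in> S"
  shows "len (star s \<otimes> x) = len (x \<otimes> s)"
proof -
  have "len (star s \<otimes> x) = len (star (x \<otimes> s))"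
    using assms tinvD[OF assms(1)] by (simp add: len_S_mult_inv)
  also have "\<dots> = len (x \<otimes> s)" using assms tinvD(1) by (intro len_star) simp
  finally show ?thesis .
qed

text \<open>The value of \<open>x \<ltimes> s\<close> for a generator \<open>s\<close>, written with
  single Demazure steps so that the Bruhat results for \<open>dem_left\<close> and
  \<open>dem_right\<close> apply.\<close>

definition tstep :: "'a \<Rightarrow> 'a \<Rightarrow> 'a" where
  "tstep x s = dem_right (dem_left (star s) x) s"

lemma tstep_dem: "x \<in> carrier W \<Longrightarrow> s \<in> S \<Longrightarrow> tstep x s = star s \<odot> x \<odot> s"
  by (simp add: tstep_def dem_S_left dem_S_right)

lemma tstep_closed [simp]: "x \<in> carrier W \<Longrightarrow> s \<in> S \<Longrightarrow> tstep x s \<in> carrier W"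
  by (simp add: tstep_def)

lemma tdc_one [simp]: "x \<in> carrier W \<Longrightarrow> x \<ltimes> \<one> = x"
  by (simp add: twisted_dem_conj_def)

lemma tdc_closed [simp]: "x \<in> carrier W \<Longrightarrow> w \<in> carrier W \<Longrightarrow> x \<ltimes> w \<in> carrier W"
  by (simp add: twisted_dem_conj_def)

lemma tdc_dem_right:
  assumes "x \<in> carrier W" "w \<in> carrier W" "s \<in> S"
  shows "x \<ltimes> dem_right w s = tstep (x \<ltimes> w) s"
proof -
  let ?a = "inv (star w)"
  \<comment> \<open>The passage from \<open>w\<close> to \<open>inv (star w)\<close> preserves
    length and turns a right factor \<open>s\<close> into a left factor
    \<open>star s\<close>.\<close>
  have "len (star s \<otimes> ?a) = len (star w \<otimes> star s)"
    using assms by (simp add: len_S_mult_inv)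
  also have "\<dots> = len (w \<otimes> s)" using len_star[of "w \<otimes> s"] assms by simp
  finally have "inv (star (dem_right w s)) = star s \<odot> ?a"
    using assms by (simp add: dem_right_def dem_S_left dem_left_def inv_mult_group)
  moreover have "dem_right w s = w \<odot> s" using assms by (simp add: dem_S_right)
  ultimately show ?thesis
    using assms by (simp add: twisted_dem_conj_def tstep_dem dem_assoc)
qed

lemma tdc_mult:
  assumes "x \<in> carrier W" "w \<in> carrier W" "s \<in> S" "len w < len (w \<otimes> s)"
  shows "x \<ltimes> (w \<otimes> s) = tstep (x \<ltimes> w) s"
  using tdc_dem_right[of x w s] assms by (simp add: dem_right_def)

lemma twisted_conj_tinv:
  assumes "x \<in> tinv" "s \<in> S"
  shows "twisted_conj W star x s \<in> tinv"
proof (cases "star s \<otimes> x = x \<otimes> s")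
  case True
  have "inv (x \<otimes> s) = star (star s \<otimes> x)"
    using assms tinvD[OF assms(1)] by (simp add: inv_mult_group star_star)
  then show ?thesis
    using True assms tinvD[OF assms(1)] by (simp add: twisted_conj_def twisted_involutions_def)
next
  case False
  have "inv (star s \<otimes> x \<otimes> s) = star (star s \<otimes> x \<otimes> s)"
    using assms tinvD[OF assms(1)] by (simp add: inv_mult_group star_star m_assoc)
  then show ?thesis
    using False assms tinvD[OF assms(1)] by (simp add: twisted_conj_def twisted_involutions_def)
qed

text \<open>If \<open>star s \<otimes> x = x \<otimes> s\<close>, the left step already ends at an
  element with descent \<open>s\<close>, so the right step does nothing. Otherwise exchange forbids
  the second multiplication to descend, and both take effect.\<close>

lemma tstep_ascent:
  assumes "x \<in> tinv" "s \<in> S" "len x < len (x \<otimes> s)"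
  shows "tstep x s = twisted_conj W star x s"
proof -
  note x = tinvD[OF assms(1)]
  have l: "dem_left (star s) x = star s \<otimes> x"
    using assms by (simp add: dem_left_def len_star_mult_tinv)
  show ?thesis
  proof (cases "star s \<otimes> x = x \<otimes> s")
    case True
    then show ?thesis
      using assms x by (simp add: tstep_def l dem_right_def twisted_conj_def)
  next
    case False
    then have "\<not> len (star s \<otimes> x \<otimes> s) < len (x \<otimes> s)"
      using refl_mult_eq_mult_S[of "star s" s x] assms x by (auto simp: len_star_mult_tinv)
    then have "\<not> len (star s \<otimes> x \<otimes> s) < len (star s \<otimes> x)"
      using assms by (simp add: len_star_mult_tinv)
    then have "len (star s \<otimes> x) < len (star s \<otimes> x \<otimes> s)"
      using len_mult_S[of "star s \<otimes> x" s] assms x by auto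
    then show ?thesis using False by (simp add: tstep_def l dem_right_def twisted_conj_def)
  qed
qed

lemma tstep_descent:
  assumes "x \<in> tinv" "s \<in> S" "\<not> len x < len (x \<otimes> s)"
  shows "tstep x s = x"
  using assms by (simp add: tstep_def dem_left_def dem_right_def len_star_mult_tinv)

lemma tstep_tinv: "x \<in> tinv \<Longrightarrow> s \<in> S \<Longrightarrow> tstep x s \<in> tinv"
  using tstep_ascent[of x s] tstep_descent[of x s] twisted_conj_tinv[of x s]
  by (cases "len x < len (x \<otimes> s)") auto

lemma ble_tstep:
  assumes "x \<in> carrier W" "s \<in> S"
  shows "x \<preceq> tstep x s"
  using ble_dem_left(1)[of x "star s"] ble_dem_right(1)[of "dem_left (star s) x" s] assms ble_trans
  unfolding tstep_def by simp

lemma tdc_tinv: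
  assumes "x \<in> tinv" "w \<in> carrier W"
  shows "x \<ltimes> w \<in> tinv"
  using assms(2)
proof (induction rule: right_induct)
  case one
  then show ?case using assms tinvD by simp
next
  case (mult w s)
  then show ?case using assms tinvD by (simp add: tdc_mult tstep_tinv)
qed

text \<open>Descents are undone by \<open>tstep\<close>: this allows induction on length within the
  twisted involutions.\<close>

lemma twisted_conj_descent:
  assumes "x \<in> tinv" "s \<in> S" "len (x \<otimes> s) < len x"
  defines "y \<equiv> twisted_conj W star x s"
  shows "len y < len (y \<otimes> s)" and "len y < len x" and "tstep y s = x"
proof -
  note x = tinvD[OF assms(1)]
  have y: "y \<in> tinv" unfolding y_def using twisted_conj_tinv assms by blast
  have *: "len y < len (y \<otimes> s) \<and> len y < len x \<and> twisted_conj W star y s = x"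
  proof (cases "star s \<otimes> x = x \<otimes> s")
    case True
    then have ys: "y = x \<otimes> s" "y = star s \<otimes> x" by (simp_all add: y_def twisted_conj_def)
    have "y \<otimes> s = x" unfolding ys(1) using assms x by simp
    moreover have "star s \<otimes> y = x" unfolding ys(2) using assms x by simp
    moreover have "len y < len x" using assms(3) ys(1) by simp
    ultimately show ?thesis by (simp add: twisted_conj_def)
  next
    case False
    then have y_eq: "y = star s \<otimes> x \<otimes> s" by (simp add: y_def twisted_conj_def)
    have sx: "star s \<otimes> (x \<otimes> s) = y" using x assms y_eq by (simp add: m_assoc)
    have ys: "y \<otimes> s = star s \<otimes> x" "star s \<otimes> y = x \<otimes> s"
      using assms(2) x by (simp_all add: y_eq m_assoc)
    \<comment> \<open>Otherwise exchange at \<open>x \<otimes> s\<close> gives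
      \<open>star s \<otimes> (x \<otimes> s) = x\<close>, hence
      \<open>star s \<otimes> x = x \<otimes> s\<close>, which this case excludes.\<close>
    have "\<not> len (x \<otimes> s) < len y"
    proof
      assume less: "len (x \<otimes> s) < len y"
      have "star s \<otimes> (x \<otimes> s) \<otimes> s = star s \<otimes> x" using sx ys(1) by simp
      then have "len (star s \<otimes> (x \<otimes> s) \<otimes> s) < len (x \<otimes> s \<otimes> s)"
        using assms(1-3) x by (simp add: len_star_mult_tinv)
      then have "star s \<otimes> (x \<otimes> s) = x \<otimes> s \<otimes> s"
        using less assms(2) x(1) unfolding sx[symmetric] by (intro refl_mult_eq_mult_S) auto
      then have "star s \<otimes> (star s \<otimes> (x \<otimes> s)) = star s \<otimes> x" using assms x by simp
      then show False using False assms x by simp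
    qed
    then have "len y < len (x \<otimes> s)"
      using len_S_mult[of "x \<otimes> s" "star s"] assms x sx by auto
    moreover note ys
    moreover have "star s \<otimes> y \<otimes> s = x" using ys assms x by simp
    ultimately show ?thesis
      using assms False by (auto simp: len_star_mult_tinv twisted_conj_def)
  qed
  then show "len y < len (y \<otimes> s)" "len y < len x" by auto
  with * show "tstep y s = x" using tstep_ascent[OF y assms(2)] by simp
qed

section \<open>Involution length and its monotonicity in the Bruhat order\<close>

lemma one_tinv: "\<one> \<in> tinv"
  by (simp add: twisted_involutions_def)

text \<open>Guarantees that the \<open>LEAST\<close> in \<open>inv_length\<close> is attained. A
  descent leads to a shorter twisted involution, from which one \<open>tstep\<close> returns to
  \<open>x\<close>.\<close>

lemma ex_tdc: "x \<in> tinv \<Longrightarrow> \<exists>w \<in> carrier W. \<one> \<ltimes> w = x"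
proof (induction "len x" arbitrary: x rule: less_induct)
  case less
  show ?case
  proof (cases "x = \<one>")
    case True
    then show ?thesis by (intro bexI[of _ \<one>]) auto
  next
    case False
    then obtain s where s: "s \<in> S" "len (x \<otimes> s) < len x"
      using right_descent_ex tinvD(1)[OF less.prems] by blast
    let ?y = "twisted_conj W star x s"
    note y = twisted_conj_descent[OF less.prems s] twisted_conj_tinv[OF less.prems s(1)]
    obtain w where w: "w \<in> carrier W" "\<one> \<ltimes> w = ?y" using less.hyps[OF y(2,4)] by blast
    show ?thesis using tdc_dem_right[of \<one> w s] w s y by (intro bexI[of _ "dem_right w s"]) auto
  qed
qed

lemma hlen_witness:
  assumes "x \<in> tinv"
  obtains w where "w \<in> carrier W" "len w = hlen x" "\<one> \<ltimes> w = x"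
proof -
  have "\<exists>n. \<exists>w \<in> carrier W. len w = n \<and> \<one> \<ltimes> w = x" using ex_tdc[OF assms] by blast
  from LeastI_ex[OF this] show ?thesis using that unfolding inv_length_def by auto
qed

lemma hlen_le: "w \<in> carrier W \<Longrightarrow> hlen (\<one> \<ltimes> w) \<le> len w"
  unfolding inv_length_def by (rule Least_le) auto

lemma hlen_tstep_le:
  assumes "x \<in> tinv" "s \<in> S"
  shows "hlen (tstep x s) \<le> Suc (hlen x)"
proof -
  obtain w where w: "w \<in> carrier W" "len w = hlen x" "\<one> \<ltimes> w = x" using hlen_witness[OF assms(1)] .
  then have "hlen (tstep x s) \<le> len (dem_right w s)"
    using hlen_le[of "dem_right w s"] tdc_dem_right[of \<one> w s] assms by simp
  also have "\<dots> \<le> Suc (len w)" using len_mult_S_le[of w s] w assms by (simp add: dem_right_def)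
  finally show ?thesis using w by simp
qed

text \<open>Drop the last letter of a shortest \<open>w\<close> with
  \<open>\<one> \<ltimes> w = x\<close>. The involution length then falls by exactly one, since one
  step raises it by at most one.\<close>

lemma hlen_last_step:
  assumes "x \<in> tinv" "x \<noteq> \<one>"
  obtains z s where "z \<in> tinv" "s \<in> S" "tstep z s = x" "hlen x = Suc (hlen z)"
proof -
  obtain w where w: "w \<in> carrier W" "len w = hlen x" "\<one> \<ltimes> w = x" using hlen_witness[OF assms(1)] .
  then have "w \<noteq> \<one>" using assms by auto
  then obtain s where s: "s \<in> S" "len (w \<otimes> s) < len w" using right_descent_ex w(1) by blast
  define v where "v = w \<otimes> s"
  have v: "v \<in> carrier W" "v \<otimes> s = w" "len w = Suc (len v)"
    using w s len_mult_S[of w s] by (auto simp: v_def)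
  have z: "\<one> \<ltimes> v \<in> tinv" using tdc_tinv one_tinv v by blast
  moreover have step: "tstep (\<one> \<ltimes> v) s = x"
    using tdc_mult[of \<one> v s] v s w by simp
  moreover have "hlen x = Suc (hlen (\<one> \<ltimes> v))"
    using hlen_tstep_le[OF z s(1)] hlen_le[OF v(1)] step w v by simp
  ultimately show ?thesis using that s by blast
qed

text \<open>Lifting on both sides: for a twisted involution \<open>y\<close>, an ascent
  \<open>s\<close> on the right is also an ascent \<open>star s\<close> on the left.\<close>

lemma ble_tstep_imp:
  assumes "y \<in> tinv" "z \<in> carrier W" "s \<in> S" "y \<preceq> tstep z s" "len y < len (y \<otimes> s)"
  shows "y \<preceq> z"
  using ble_dem_right_imp[of y "dem_left (star s) z" s] ble_dem_left_imp[of y "star s" z] assms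
  by (simp add: tstep_def len_star_mult_tinv)

text \<open>Undo the last step \<open>s\<close> of \<open>z\<close>. If \<open>s\<close> is an
  ascent of \<open>y\<close>, then \<open>y\<close> already lies below the predecessor
  \<open>z'\<close>; otherwise \<open>s\<close> is undone in \<open>y\<close> as well.\<close>

lemma hlen_mono:
  assumes "y \<in> tinv" "z \<in> tinv" "y \<preceq> z"
  shows "hlen y \<le> hlen z \<and> (hlen y = hlen z \<longrightarrow> y = z)"
  using assms
proof (induction "hlen z" arbitrary: y z rule: less_induct)
  case less
  show ?case
  proof (cases "z = \<one>")
    case True
    then show ?thesis using less.prems ble_one by auto
  next
    case False
    then obtain z' s where z': "z' \<in> tinv" "s \<in> S" "tstep z' s = z" "hlen z = Suc (hlen z')"
      using hlen_last_step less.prems(2) by metis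
    note IH = less.hyps[of z', OF _ _ z'(1)]
    show ?thesis
    proof (cases "len y < len (y \<otimes> s)")
      case True
      then have "y \<preceq> z'"
        using ble_tstep_imp[of y z' s] less.prems z' tinvD(1) by simp
      then show ?thesis using IH[of y] less.prems z' by simp
    next
      case False
      then have ys: "len (y \<otimes> s) < len y"
        using len_mult_S[of y s] tinvD(1)[OF less.prems(1)] z' by auto
      let ?y' = "twisted_conj W star y s"
      note y' = twisted_conj_descent[OF less.prems(1) z'(2) ys] twisted_conj_tinv[OF less.prems(1) z'(2)]
      \<comment> \<open>The element \<open>?y'\<close> ascends at \<open>s\<close> and lies below
        \<open>z\<close>, hence below \<open>z'\<close>. Equality of involution lengths for
        \<open>y\<close> and \<open>z\<close> forces \<open>?y' = z'\<close>, and applying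
        \<open>tstep\<close> gives \<open>y = z\<close>.\<close>
      have "?y' \<preceq> y" using ble_tstep[of ?y' s] y' tinvD(1) z' by simp
      then have "?y' \<preceq> z" using less.prems ble_trans by blast
      then have "?y' \<preceq> z'"
        using ble_tstep_imp[of ?y' z' s] y' z' tinvD(1) by simp
      then have "hlen ?y' \<le> hlen z'" "hlen ?y' = hlen z' \<longrightarrow> ?y' = z'"
        using IH[of ?y'] y' z' by simp_all
      moreover have "hlen y \<le> Suc (hlen ?y')"
        using hlen_tstep_le[of ?y' s] y' z' by simp
      ultimately show ?thesis using y'(3) z'(3,4) by auto
    qed
  qed
qed

section \<open>Bounds for the lengths of elements of the Hecke sets\<close>

lemma hlen_tdc_le:
  assumes "x \<in> tinv" "w \<in> carrier W"
  shows "hlen (x \<ltimes> w) \<le> hlen x + len w"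
  using assms(2)
proof (induction rule: right_induct)
  case one
  then show ?case using tinvD assms by simp
next
  case (mult w s)
  then show ?case
    using hlen_tstep_le[of "x \<ltimes> w" s] tdc_tinv[OF assms(1)] tinvD assms by (simp add: tdc_mult)
qed

lemma weak_le_hecke:
  assumes "twisted_weak_le W S star x y"
  shows "hlen x \<le> hlen y" and "\<exists>w \<in> carrier W. x \<ltimes> w = y \<and> len w \<le> hlen y - hlen x"
proof -
  let ?R = "{(w, twisted_conj W star w s) | w s. w \<in> tinv \<and> s \<in> S \<and>
    hlen w < hlen (twisted_conj W star w s)}"
  have x: "x \<in> tinv" and "(x, y) \<in> ?R\<^sup>*" using assms by (auto simp: twisted_weak_le_def)
  from this(2)
  \<comment> \<open>The inequality is carried along because the subtraction of natural numbers is
    truncated.\<close>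
  have "hlen x \<le> hlen y \<and> (\<exists>w \<in> carrier W. x \<ltimes> w = y \<and> len w \<le> hlen y - hlen x)"
  proof (induction rule: rtrancl_induct)
    case base
    then show ?case using x tinvD by (auto intro!: bexI[of _ \<one>])
  next
    case (step y z)
    then obtain s where s: "y \<in> tinv" "s \<in> S" "z = twisted_conj W star y s" "hlen y < hlen z" by auto
    obtain w where w: "w \<in> carrier W" "x \<ltimes> w = y" "len w \<le> hlen y - hlen x"
      using step.IH by blast
    \<comment> \<open>At a descent, \<open>z\<close> would lie below \<open>y\<close> in the Bruhat
      order, so its involution length could not be larger.\<close>
    have "len y < len (y \<otimes> s)"
    proof (rule ccontr)
      assume "\<not> len y < len (y \<otimes> s)"
      then have "len (y \<otimes> s) < len y"
        using len_mult_S[of y s] tinvD(1)[OF s(1)] s by auto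
      note d = twisted_conj_descent[OF s(1,2) this] twisted_conj_tinv[OF s(1,2)]
      then have "z \<preceq> y" using ble_tstep[of z s] tinvD(1) s by simp
      then show False using hlen_mono[of z y] d s by auto
    qed
    then have z: "tstep y s = z" using tstep_ascent s by simp
    then have "x \<ltimes> dem_right w s = z" using tdc_dem_right[of x w s] x tinvD w s by simp
    moreover have "len (dem_right w s) \<le> Suc (len w)"
      using len_mult_S_le[of w s] w s by (simp add: dem_right_def)
    ultimately show ?case
      using step.IH w s by (auto intro!: bexI[of _ "dem_right w s"])
  qed
  then show "hlen x \<le> hlen y" "\<exists>w \<in> carrier W. x \<ltimes> w = y \<and> len w \<le> hlen y - hlen x" by auto
qed

text \<open>Equality in \<open>hlen_tdc_le\<close> means that every letter of \<open>w\<close>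
  raises the involution length by one, so no letter may be absorbed on the way.\<close>

lemma dem_eq_mult_of_hlen:
  assumes "x \<in> tinv" "w \<in> carrier W" "hlen (x \<ltimes> w) = hlen x + len w"
  shows "x \<odot> w = x \<otimes> w"
  using assms(2,3)
proof (induction rule: right_induct)
  case one
  then show ?case using assms tinvD by simp
next
  case (mult w s)
  note x = tinvD(1)[OF assms(1)]
  let ?z = "x \<ltimes> w"
  have z: "?z \<in> tinv" using tdc_tinv mult assms by blast
  have step: "x \<ltimes> (w \<otimes> s) = tstep ?z s" using tdc_mult mult x by simp
  have "hlen (tstep ?z s) \<le> Suc (hlen ?z)" using hlen_tstep_le z mult by blast
  moreover have "hlen ?z \<le> hlen x + len w" using hlen_tdc_le assms mult by blast
  ultimately have "hlen ?z = hlen x + len w" "tstep ?z s \<noteq> ?z"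
    using mult step by auto
  then have xw: "x \<odot> w = x \<otimes> w" and asc: "len ?z < len (?z \<otimes> s)"
    using mult tstep_descent[OF z] by auto
  have "w \<otimes> s = w \<odot> s" using mult by (simp add: dem_S_right dem_right_def)
  then have "x \<odot> (w \<otimes> s) = x \<odot> w \<odot> s" using dem_assoc[of x w s] mult x by simp
  then have dr: "x \<odot> (w \<otimes> s) = dem_right (x \<otimes> w) s"
    using mult x xw by (simp add: dem_S_right)
  \<comment> \<open>If \<open>x \<odot> w\<close> absorbed \<open>s\<close>, then by associativity
    so would \<open>?z\<close>, which has \<open>x \<odot> w\<close> as its right factor. But
    \<open>s\<close> is an ascent of \<open>?z\<close>.\<close>
  have "len (x \<otimes> w) < len (x \<otimes> w \<otimes> s)"
  proof (rule ccontr)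
    assume "\<not> ?thesis"
    then have "x \<odot> w \<odot> s = x \<odot> w" using mult x xw by (simp add: dem_S_right dem_right_def)
    then have "?z \<odot> s = ?z"
      using mult x by (simp add: twisted_dem_conj_def dem_assoc)
    then have "dem_right ?z s = ?z" using mult x by (simp add: dem_S_right)
    with asc show False by (auto simp: dem_right_def split: if_splits)
  qed
  then show ?case using dr mult x by (simp add: dem_right_def m_assoc)
qed

theorem atoms_eq_atoms':
  assumes "twisted_weak_le W S star x y"
  shows "atoms W S star x y = atoms' W S star x y"
proof -
  let ?B = "hecke_set W S star x y" and ?B' = "hecke_set' W S star x y"
  have x: "x \<in> tinv" and y: "y \<in> tinv" using assms by (simp_all add: twisted_weak_le_def)
  note xc = tinvD(1)[OF x] and yc = tinvD(1)[OF y]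
  define k where "k = hlen y - hlen x"
  have k: "hlen y = hlen x + k" using weak_le_hecke(1)[OF assms] by (simp add: k_def)
  obtain a where a: "a \<in> ?B" "len a \<le> k"
    using weak_le_hecke(2)[OF assms] by (auto simp: hecke_set_def k_def)
  have B_ge: "k \<le> len w" if "w \<in> ?B" for w
    using hlen_tdc_le[OF x, of w] that k by (auto simp: hecke_set_def)
  have B'_ge: "k \<le> len w \<and> (len w = k \<longrightarrow> w \<in> ?B)" if "w \<in> ?B'" for w
  proof -
    have w: "w \<in> carrier W" "star w \<otimes> y \<preceq> x \<otimes> w" using that by (simp_all add: hecke_set'_def)
    let ?v = "inv (star w)"
    have "?v \<otimes> (star w \<otimes> y) \<preceq> ?v \<odot> (star w \<otimes> y)"
      using mult_ble_dem[of ?v "star w \<otimes> y"] w yc by simp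
    then have "y \<preceq> ?v \<odot> (star w \<otimes> y)" using w yc by simp
    also have "?v \<odot> (star w \<otimes> y) \<preceq> ?v \<odot> (x \<otimes> w)" using w by (intro dem_mono_right) auto
    also have "?v \<odot> (x \<otimes> w) \<preceq> ?v \<odot> (x \<odot> w)"
      using w xc mult_ble_dem[of x w] by (intro dem_mono_right) auto
    also have "?v \<odot> (x \<odot> w) = x \<ltimes> w"
      using w xc by (simp add: twisted_dem_conj_def dem_assoc)
    finally have "y \<preceq> x \<ltimes> w" .
    from hlen_mono[OF y tdc_tinv[OF x w(1)] this] hlen_tdc_le[OF x w(1)] k
    show ?thesis using w by (auto simp: hecke_set_def)
  qed
  have B_B': "w \<in> ?B'" if "w \<in> ?B" "len w = k" for w
  proof -
    have w: "w \<in> carrier W" "x \<ltimes> w = y" using that by (simp_all add: hecke_set_def)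
    let ?v = "inv (star w)"
    have "x \<odot> w = x \<otimes> w" using dem_eq_mult_of_hlen[OF x w(1)] w k that by simp
    then have "?v \<odot> (x \<otimes> w) = y"
      using w xc by (simp add: twisted_dem_conj_def dem_assoc)
    then have "star w \<otimes> y \<preceq> x \<otimes> w"
      using inv_mult_dem_ble[of ?v "x \<otimes> w"] w xc by simp
    then show ?thesis using w by (simp add: hecke_set'_def)
  qed
  \<comment> \<open>So \<open>a\<close> attains the bound \<open>k\<close> in \<open>?B\<close>, and
    by \<open>B_B'\<close> also in \<open>?B'\<close>. The minimal elements of either set are those
    of length \<open>k\<close>, and these agree.\<close>
  have "len a = k" using B_ge a by force
  then show ?thesis
    unfolding atoms_def atoms'_def min_length_elements_def
    using B_ge B'_ge B_B' a by (auto 0 3) (metis le_antisym)+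
qed

end

theorem theorem4p13:
  fixes W :: "('a, 'b) monoid_scheme"
    and S :: "'a set"
    and star :: "'a \<Rightarrow> 'a"
    and w\<^sub>0 x y :: 'a
  assumes "twisted_coxeter_system W S star"
    and "finite (carrier W)"
    and "is_longest W S w\<^sub>0"
    and "x \<in> twisted_involutions W star"
    and "y \<in> twisted_involutions W star"
    and "twisted_weak_le W S star x y"
    and "cox_length W S x = inv_length W S star x \<or>
         int (cox_length W S w\<^sub>0) - int (cox_length W S y)
           = int (inv_length W S star w\<^sub>0) - int (inv_length W S star y)"
  shows "atoms W S star x y = atoms' W S star x y"
  using twisted_coxeter_system.atoms_eq_atoms'[OF assms(1,6)] .

end
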